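(* Let $q,k\ge 1$ be fixed integers with $k\ge q$, and let $v_1,\dots,v_k\in\mathbb{R}^q$, $v_l=(v_{l1},\dots,v_{lq})$, be fixed pairwise distinct vectors. For each $n\ge 1$ let $N=kn$ and consider the linear regression model $y_j=\sum_{i=1}^q\theta_i x_{ji}+\epsilon_j$, $j=1,\dots,N$, where $\theta=(\theta_1,\dots,\theta_q)\in\mathbb{R}^q$ is an unknown parameter, the errors $\epsilon_j$ are i.i.d. random variables with distribution function $F$, and the design is as follows: $\{1,\dots,N\}$ is the disjoint union of sets $I_1,\dots,I_k$ with $\operatorname{card}(I_l)=n$, and $(x_{j1},\dots,x_{jq})=v_l$ for all $j\in I_l$, $l=1,\dots,k$. Assume that (A1) the random variables $\epsilon_j$ are symmetric ($\epsilon_j$ and $-\epsilon_j$ have the same distribution); (A2) there are constants $b_n>0$ and $a_n\in\mathbb{R}$ such that $b_n(\max_{1\le j\le n}\epsilon_j-a_n)$ converges in distribution, as $n\to\infty$, to a random variable with distribution function $G$, where $G$ is one of the extreme value distribution functions $\Phi_\alpha$ ($\alpha>0$), $\Psi_\alpha$ ($\alpha>0$), $\Lambda$; (A3) the $k\times q$ matrix $V=(v_{li})$ has a square submatrix $\widetilde V$ of order $q$ (formed by $q$ of its rows) with $\det\widetilde V\ne 0$; (A4) $b_n\to\infty$ as $n\to\infty$. Then the minimax estimator $\widehat\theta=(\widehat\theta_1,\dots,\widehat\theta_q)$ of $\theta$ is consistent (that is, $\widehat\theta\to\theta$ in probability as $n\to\infty$), and $$\widehat\theta_i-\theta_i\overset{P}{=}O(b_n^{-1}),\qquad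 i=1,\dots,q.$$
   Context: The minimax estimator (MME) of $\theta$ by the observations $y_1,\dots,y_N$ is a random vector $\widehat\theta$ such that $\Delta(\widehat\theta)=\min_{\tau\in\mathbb{R}^q}\Delta(\tau)$, where $\Delta(\tau)=\max_{1\le j\le N}\bigl|y_j-\sum_{i=1}^q\tau_i x_{ji}\bigr|$. For a number sequence $b_n\to\infty$ and a random sequence $(\xi_n)$, the notation $\xi_n\overset{P}{=}O(b_n^{-1})$ means $\sup_n\mathbb{P}(b_n|\xi_n|>C)\to 0$ as $C\to\infty$. The extreme value distribution functions are: $\Phi_\alpha(x)=0$ for $x\le 0$ and $\Phi_\alpha(x)=\exp(-x^{-\alpha})$ for $x>0$ ($\alpha>0$); $\Psi_\alpha(x)=\exp(-(-x)^\alpha)$ for $x\le 0$ and $\Psi_\alpha(x)=1$ for $x>0$ ($\alpha>0$); $\Lambda(x)=\exp(-e^{-x})$, $x\in\mathbb{R}$. *)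

theory Defs
  imports "HOL-Probability.Probability"
begin

definition frechet_df :: "real \<Rightarrow> real \<Rightarrow> real" where
  "frechet_df \<alpha> x = (if x \<le> 0 then 0 else exp (- (x powr (- \<alpha>))))"

definition weibull_df :: "real \<Rightarrow> real \<Rightarrow> real" where
  "weibull_df \<alpha> x = (if x \<le> 0 then exp (- ((- x) powr \<alpha>)) else 1)"

definition gumbel_df :: "real \<Rightarrow> real" where
  "gumbel_df x = exp (- exp (- x))"

definition extreme_value_df :: "(real \<Rightarrow> real) \<Rightarrow> bool" where
  "extreme_value_df G \<longleftrightarrow>
     (\<exists>\<alpha>>0. G = frechet_df \<alpha>) \<or> (\<exists>\<alpha>>0. G = weibull_df \<alpha>) \<or> G = gumbel_df"

definition max_abs_residual ::
  "nat \<Rightarrow> (nat \<Rightarrow> real ^ 'q) \<Rightarrow> (nat \<Rightarrow> real) \<Rightarrow> real ^ 'q \<Rightarrow> real" where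
  "max_abs_residual N x y \<tau> = Max ((\<lambda>j. \<bar>y j - (\<Sum>i\<in>UNIV. \<tau> $ i * x j $ i)\<bar>) ` {1..N})"

text \<open>The minimiser need not be unique, so minimality is a predicate on estimators:
  a minimax estimator is any random vector that attains the minimum at every outcome.\<close>

definition minimax_estimator ::
  "'a measure \<Rightarrow> nat \<Rightarrow> (nat \<Rightarrow> real ^ 'q) \<Rightarrow> (nat \<Rightarrow> 'a \<Rightarrow> real) \<Rightarrow> ('a \<Rightarrow> real ^ 'q) \<Rightarrow> bool" where
  "minimax_estimator M N x y T \<longleftrightarrow>
     T \<in> borel_measurable M \<and>
     (\<forall>\<omega>\<in>space M. \<forall>\<tau>. max_abs_residual N x (\<lambda>j. y j \<omega>) (T \<omega>)
                          \<le> max_abs_residual N x (\<lambda>j. y j \<omega>) \<tau>)"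

definition tendsto_in_prob ::
  "'a measure \<Rightarrow> (nat \<Rightarrow> 'a \<Rightarrow> 'b::metric_space) \<Rightarrow> 'b \<Rightarrow> bool" where
  "tendsto_in_prob M X c \<longleftrightarrow>
     (\<forall>e>0. (\<lambda>n. measure M {\<omega> \<in> space M. dist (X n \<omega>) c > e}) \<longlonglongrightarrow> 0)"

text \<open>All sequences are indexed by \<open>n \<ge> 1\<close>. The supremum is over a nonempty set of
  probabilities, hence bounded, so the real-valued \<open>SUP\<close> is the genuine one.\<close>

definition bigO_in_prob ::
  "'a measure \<Rightarrow> (nat \<Rightarrow> 'a \<Rightarrow> real) \<Rightarrow> (nat \<Rightarrow> real) \<Rightarrow> bool" where
  "bigO_in_prob M \<xi> b \<longleftrightarrow>
     ((\<lambda>C. SUP n\<in>{1..}. measure M {\<omega> \<in> space M. b n * \<bar>\<xi> n \<omega>\<bar> > C}) \<longlongrightarrow> 0) at_top"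

end

theory Submission
  imports Defs "HOL-Real_Asymp.Real_Asymp"
begin

text \<open>
  Write \<open>u = \<theta>h - \<theta>\<close>. On a block of constant design \<open>v\<close> every residual of the estimator is
  \<open>\<epsilon> - v \<bullet> u\<close>, while the residuals of the true parameter are the errors themselves. Minimality
  therefore forces each \<open>\<bar>\<epsilon> - v \<bullet> u\<bar>\<close> to be at most the largest absolute error in the
  whole sample. If the largest \<open>\<epsilon>\<close> and the largest \<open>-\<epsilon>\<close> of every block lie within \<open>c\<close> of a common
  centre \<open>a\<close>, then the largest absolute error is at most \<open>a + c\<close>, and comparing it with the extreme
  errors of a block, which exceed \<open>a - c\<close> in both directions, gives \<open>\<bar>v \<bullet> u\<bar> \<le> 2 * c\<close>
  (\<open>minimiser_block_shift_le\<close>). Since \<open>V\<close> has full column rank, these bounds on the entries of \<open>V u\<close>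
  bound \<open>u\<close> itself by a fixed multiple of \<open>c\<close> (\<open>norm_le_of_matrix_vector_bounds\<close>).

  It remains to see that with high probability \<open>c\<close> can be taken of order \<open>1 / b n\<close>, uniformly in \<open>n\<close>.
  By independence and symmetry, the \<open>2 * CARD('k)\<close> block maxima of \<open>\<epsilon>\<close> and \<open>-\<epsilon>\<close> all have the
  distribution of the maximum of the first \<open>n\<close> errors (\<open>prob_Max_le_indep\<close>). Normalised by \<open>a n\<close> and
  \<open>b n\<close>, it converges weakly to a proper distribution, and a weakly convergent sequence of
  distributions loses no mass at infinity (\<open>weak_conv_uniform_upper_tail\<close>,
  \<open>weak_conv_uniform_lower_tail\<close>). The extreme value laws enter through their limits \<open>0\<close> and \<open>1\<close> at
  infinity and their continuity far out, where weak convergence gives pointwise convergence. A union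
  bound over the blocks finishes the argument.
\<close>

section \<open>Tails of the extreme value laws and of weakly convergent sequences\<close>

text \<open>Far out, a piecewise defined distribution function is given by one of its branches \<open>g\<close>, so
  its limit and its continuity can be read off from \<open>g\<close>.\<close>

lemma tendsto_and_isCont_at_top_cong:
  fixes G g :: "real \<Rightarrow> real"
  assumes eq: "\<And>x. x > c \<Longrightarrow> G x = g x" and lim: "(g \<longlongrightarrow> L) at_top"
    and cont: "continuous_on {c<..} g"
  shows "(G \<longlongrightarrow> L) at_top \<and> (\<forall>\<^sub>F x in at_top. isCont G x)"
proof
  have "\<forall>\<^sub>F x in at_top. g x = G x"
    using eventually_gt_at_top[of c] by eventually_elim (simp add: eq)
  then show "(G \<longlongrightarrow> L) at_top"
    by (rule Lim_transform_eventually[OF lim])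
  have "continuous_on {c<..} G"
    using cont by (rule continuous_on_eq) (simp add: eq)
  then have "isCont G x" if "x > c" for x
    using that by (simp add: continuous_on_eq_continuous_at)
  then show "\<forall>\<^sub>F x in at_top. isCont G x"
    by (rule eventually_mono[OF eventually_gt_at_top[of c]])
qed

lemma tendsto_and_isCont_at_bot_cong:
  fixes G g :: "real \<Rightarrow> real"
  assumes eq: "\<And>x. x < c \<Longrightarrow> G x = g x" and lim: "(g \<longlongrightarrow> L) at_bot"
    and cont: "continuous_on {..<c} g"
  shows "(G \<longlongrightarrow> L) at_bot \<and> (\<forall>\<^sub>F x in at_bot. isCont G x)"
proof
  have "\<forall>\<^sub>F x in at_bot. g x = G x"
    using eventually_gt_at_bot[of c] by eventually_elim (simp add: eq)
  then show "(G \<longlongrightarrow> L) at_bot"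
    by (rule Lim_transform_eventually[OF lim])
  have "continuous_on {..<c} G"
    using cont by (rule continuous_on_eq) (simp add: eq)
  then have "isCont G x" if "x < c" for x
    using that by (simp add: continuous_on_eq_continuous_at)
  then show "\<forall>\<^sub>F x in at_bot. isCont G x"
    by (rule eventually_mono[OF eventually_gt_at_bot[of c]])
qed

lemma extreme_value_df_cases:
  assumes "extreme_value_df G"
  obtains (frechet) \<alpha> where "\<alpha> > 0" "G = frechet_df \<alpha>"
    | (weibull) \<alpha> where "\<alpha> > 0" "G = weibull_df \<alpha>"
    | (gumbel) "G = gumbel_df"
  using assms unfolding extreme_value_df_def by blast

lemma extreme_value_df_at_top:
  assumes "extreme_value_df G"
  shows "(G \<longlongrightarrow> 1) at_top \<and> (\<forall>\<^sub>F x in at_top. isCont G x)"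
  using assms
proof (cases rule: extreme_value_df_cases)
  case (frechet \<alpha>)
  show ?thesis
  proof (rule tendsto_and_isCont_at_top_cong)
    show "G x = exp (- (x powr - \<alpha>))" if "x > 0" for x
      using that frechet(2) by (simp add: frechet_df_def)
    have "((\<lambda>x. x powr - \<alpha>) \<longlongrightarrow> 0) at_top"
      using frechet(1) by (intro tendsto_neg_powr filterlim_ident) simp
    then show "((\<lambda>x. exp (- (x powr - \<alpha>))) \<longlongrightarrow> 1) at_top"
      using tendsto_exp[OF tendsto_minus] by fastforce
    show "continuous_on {0<..} (\<lambda>x. exp (- (x powr - \<alpha>)))"
      by (intro continuous_intros) auto
  qed
next
  case (weibull \<alpha>)
  show ?thesis
    by (rule tendsto_and_isCont_at_top_cong[of 0 _ "\<lambda>_. 1"]) (simp_all add: weibull(2) weibull_df_def)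
next
  case gumbel
  have "((\<lambda>x::real. exp (- exp (- x))) \<longlongrightarrow> 1) at_top" by real_asymp
  then show ?thesis
    by (intro tendsto_and_isCont_at_top_cong[of 0 _ "\<lambda>x. exp (- exp (- x))"] continuous_intros)
      (simp_all add: gumbel gumbel_df_def)
qed

lemma extreme_value_df_at_bot:
  assumes "extreme_value_df G"
  shows "(G \<longlongrightarrow> 0) at_bot \<and> (\<forall>\<^sub>F x in at_bot. isCont G x)"
  using assms
proof (cases rule: extreme_value_df_cases)
  case (frechet \<alpha>)
  show ?thesis
    by (rule tendsto_and_isCont_at_bot_cong[of 0 _ "\<lambda>_. 0"]) (simp_all add: frechet(2) frechet_df_def)
next
  case (weibull \<alpha>)
  show ?thesis
  proof (rule tendsto_and_isCont_at_bot_cong)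
    show "G x = exp (- ((- x) powr \<alpha>))" if "x < 0" for x
      using that weibull(2) by (simp add: weibull_df_def)
    have "LIM x at_bot. (- x) powr \<alpha> :> at_top"
      using filterlim_compose[OF real_powr_at_top[OF weibull(1)] filterlim_uminus_at_top_at_bot] .
    then show "((\<lambda>x. exp (- ((- x) powr \<alpha>))) \<longlongrightarrow> 0) at_bot"
      by (intro filterlim_compose[OF exp_at_bot]) (simp add: filterlim_uminus_at_bot)
    show "continuous_on {..<0} (\<lambda>x. exp (- ((- x) powr \<alpha>)))"
      by (intro continuous_intros) auto
  qed
next
  case gumbel
  have "((\<lambda>x::real. exp (- exp (- x))) \<longlongrightarrow> 0) at_bot" by real_asymp
  then show ?thesis
    by (intro tendsto_and_isCont_at_bot_cong[of 0 _ "\<lambda>x. exp (- exp (- x))"] continuous_intros)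
      (simp_all add: gumbel gumbel_df_def)
qed

text \<open>All but finitely many members of the sequence inherit the bound from \<open>G\<close> at one continuity
  point, and the remaining ones satisfy it sufficiently far out because each is a distribution.\<close>

lemma weak_conv_uniform_upper_tail:
  assumes \<mu>: "\<And>n. real_distribution (\<mu> n)"
    and conv: "weak_conv (\<lambda>n. cdf (\<mu> n)) G"
    and lim: "(G \<longlongrightarrow> 1) at_top" and cont: "\<forall>\<^sub>F x in at_top. isCont G x"
    and "\<delta> > 0"
  shows "\<forall>\<^sub>F x in at_top. \<forall>n. cdf (\<mu> n) x > 1 - \<delta>"
proof -
  have "\<forall>\<^sub>F x in at_top. G x > 1 - \<delta>"
    using lim \<open>\<delta> > 0\<close> by (intro order_tendstoD) auto
  with cont have "\<forall>\<^sub>F x in at_top. isCont G x \<and> G x > 1 - \<delta>"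
    by eventually_elim auto
  then obtain x0 where x0: "isCont G x0" "G x0 > 1 - \<delta>"
    using eventually_happens[of _ "at_top :: real filter"] by auto
  from x0(1) conv have "(\<lambda>n. cdf (\<mu> n) x0) \<longlonglongrightarrow> G x0"
    by (simp add: weak_conv_def)
  then have "\<forall>\<^sub>F n in sequentially. cdf (\<mu> n) x0 > 1 - \<delta>"
    using x0(2) by (intro order_tendstoD) auto
  then obtain m where m: "\<And>n. n \<ge> m \<Longrightarrow> cdf (\<mu> n) x0 > 1 - \<delta>"
    by (auto simp: eventually_sequentially)
  have "\<forall>\<^sub>F x in at_top. cdf (\<mu> n) x > 1 - \<delta>" for n
  proof -
    interpret real_distribution "\<mu> n" by (rule \<mu>)
    show ?thesis using cdf_lim_at_top_prob \<open>\<delta> > 0\<close> by (intro order_tendstoD) auto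
  qed
  then have "\<forall>\<^sub>F x in at_top. \<forall>n\<in>{..<m}. cdf (\<mu> n) x > 1 - \<delta>"
    by (intro eventually_ball_finite) auto
  with eventually_ge_at_top[of x0] show ?thesis
  proof eventually_elim
    case (elim x)
    have "cdf (\<mu> n) x > 1 - \<delta>" if "n \<ge> m" for n
    proof -
      interpret real_distribution "\<mu> n" by (rule \<mu>)
      show ?thesis using cdf_nondecreasing[OF elim(1)] m[OF that] by linarith
    qed
    with elim show ?case by (metis lessThan_iff not_less)
  qed
qed

lemma weak_conv_uniform_lower_tail:
  assumes \<mu>: "\<And>n. real_distribution (\<mu> n)"
    and conv: "weak_conv (\<lambda>n. cdf (\<mu> n)) G"
    and lim: "(G \<longlongrightarrow> 0) at_bot" and cont: "\<forall>\<^sub>F x in at_bot. isCont G x"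
    and "\<delta> > 0"
  shows "\<forall>\<^sub>F x in at_bot. \<forall>n. cdf (\<mu> n) x < \<delta>"
proof -
  have "\<forall>\<^sub>F x in at_bot. G x < \<delta>"
    using lim \<open>\<delta> > 0\<close> by (intro order_tendstoD) auto
  with cont have "\<forall>\<^sub>F x in at_bot. isCont G x \<and> G x < \<delta>"
    by eventually_elim auto
  then obtain x0 where x0: "isCont G x0" "G x0 < \<delta>"
    using eventually_happens[of _ "at_bot :: real filter"] by auto
  from x0(1) conv have "(\<lambda>n. cdf (\<mu> n) x0) \<longlonglongrightarrow> G x0"
    by (simp add: weak_conv_def)
  then have "\<forall>\<^sub>F n in sequentially. cdf (\<mu> n) x0 < \<delta>"
    using x0(2) by (intro order_tendstoD) auto
  then obtain m where m: "\<And>n. n \<ge> m \<Longrightarrow> cdf (\<mu> n) x0 < \<delta>"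
    by (auto simp: eventually_sequentially)
  have "\<forall>\<^sub>F x in at_bot. cdf (\<mu> n) x < \<delta>" for n
  proof -
    interpret real_distribution "\<mu> n" by (rule \<mu>)
    show ?thesis using cdf_lim_at_bot \<open>\<delta> > 0\<close> by (intro order_tendstoD) auto
  qed
  then have "\<forall>\<^sub>F x in at_bot. \<forall>n\<in>{..<m}. cdf (\<mu> n) x < \<delta>"
    by (intro eventually_ball_finite) auto
  with eventually_le_at_bot[of x0] show ?thesis
  proof eventually_elim
    case (elim x)
    have "cdf (\<mu> n) x < \<delta>" if "n \<ge> m" for n
    proof -
      interpret real_distribution "\<mu> n" by (rule \<mu>)
      show ?thesis using cdf_nondecreasing[OF elim(1)] m[OF that] by linarith
    qed
    with elim show ?case by (metis lessThan_iff not_less)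
  qed
qed

section \<open>Maxima of independent variables\<close>

lemma (in prob_space) prob_Max_le_indep:
  fixes X :: "'i \<Rightarrow> 'a \<Rightarrow> real"
  assumes indep: "indep_vars (\<lambda>_. borel) X A"
    and df: "\<And>j. j \<in> A \<Longrightarrow> cdf (distr M borel (X j)) = F"
    and J: "J \<subseteq> A" "finite J" "J \<noteq> {}"
  shows "prob {\<omega> \<in> space M. Max ((\<lambda>j. X j \<omega>) ` J) \<le> t} = F t ^ card J"
proof -
  have meas: "X j \<in> borel_measurable M" if "j \<in> J" for j
    using indep J that by (auto simp: indep_vars_def)
  have "{\<omega> \<in> space M. Max ((\<lambda>j. X j \<omega>) ` J) \<le> t} = (\<Inter>j\<in>J. X j -` {..t} \<inter> space M)"
    using J by (auto simp: Max_le_iff)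
  moreover have "prob (\<Inter>j\<in>J. X j -` {..t} \<inter> space M) = (\<Prod>j\<in>J. prob (X j -` {..t} \<inter> space M))"
    using J by (intro indep_varsD_finite[OF indep_vars_subset[OF indep J(1)]]) auto
  moreover have "prob (X j -` {..t} \<inter> space M) = F t" if "j \<in> J" for j
    using df[of j] that J meas[OF that] by (auto simp: cdf_def measure_distr)
  ultimately show ?thesis by simp
qed

section \<open>The deterministic bound on the estimation error\<close>

text \<open>A nonsingular square submatrix makes \<open>V\<close> injective, and an injective linear map between
  finite-dimensional spaces is bounded below.\<close>

lemma norm_le_of_matrix_vector_bounds:
  fixes V :: "real ^ 'q ^ 'k"
  assumes "det (\<chi> i. row (r i) V) \<noteq> 0"
  shows "\<exists>K>0. \<forall>u c. (\<forall>l. \<bar>(V *v u) $ l\<bar> \<le> c) \<longrightarrow> norm u \<le> K * c"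
proof -
  let ?A = "(\<chi> i. row (r i) V) :: real ^ 'q ^ 'q"
  have "inj (\<lambda>u. V *v u)"
  proof (rule injI)
    fix u w assume "V *v u = V *v w"
    then have "?A *v u = ?A *v w"
      by (simp add: vec_eq_iff matrix_vector_mult_def row_def)
    moreover have "invertible ?A"
      using assms by (simp add: invertible_det_nz)
    ultimately show "u = w"
      by (metis inj_matrix_vector_mult injD)
  qed
  then obtain B where B: "B > 0" "\<And>u. B * norm u \<le> norm (V *v u)"
    using linear_inj_bounded_below_pos[OF matrix_vector_mul_linear] by (metis mult.commute)
  show ?thesis
  proof (intro exI conjI allI impI)
    show "real CARD('k) / B > 0" using B(1) by simp
    fix u :: "real ^ 'q" and c
    assume c: "\<forall>l. \<bar>(V *v u) $ l\<bar> \<le> c"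
    have "B * norm u \<le> (\<Sum>l\<in>UNIV. \<bar>(V *v u) $ l\<bar>)"
      using B(2)[of u] norm_le_l1_cart[of "V *v u"] by linarith
    also have "\<dots> \<le> real CARD('k) * c"
      using sum_bounded_above[of UNIV "\<lambda>l. \<bar>(V *v u) $ l\<bar>" c] c by simp
    finally show "norm u \<le> real CARD('k) / B * c"
      using B(1) by (simp add: field_simps)
  qed
qed

text \<open>The bounds \<open>upper\<close> make \<open>a + c\<close> a bound for every residual of \<open>\<theta>\<close>, hence, by minimality,
  for every residual of \<open>T\<close>. The bounds \<open>lower\<close> exhibit an error above \<open>a - c\<close> and one below
  \<open>-(a - c)\<close> in the block, and their residuals would leave this range if \<open>v \<bullet> (T - \<theta>)\<close> exceeded
  \<open>2 * c\<close> in absolute value.\<close>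

lemma minimiser_block_shift_le:
  fixes x :: "nat \<Rightarrow> real ^ 'q" and y e :: "nat \<Rightarrow> real"
  assumes min: "\<And>\<tau>. max_abs_residual N x y T \<le> max_abs_residual N x y \<tau>"
    and model: "\<And>j. j \<in> {1..N} \<Longrightarrow> y j = (\<Sum>i\<in>UNIV. \<theta> $ i * x j $ i) + e j"
    and upper: "\<And>j. j \<in> {1..N} \<Longrightarrow> e j \<le> a + c" "\<And>j. j \<in> {1..N} \<Longrightarrow> - e j \<le> a + c"
    and block: "J \<subseteq> {1..N}" "\<And>j. j \<in> J \<Longrightarrow> x j = v"
    and lower: "\<exists>j\<in>J. a - c < e j" "\<exists>j\<in>J. a - c < - e j"
  shows "\<bar>v \<bullet> (T - \<theta>)\<bar> \<le> 2 * c"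
proof -
  have nonempty: "{1..N} \<noteq> {}"
    using block(1) lower(1) by auto
  have resid_\<theta>: "y j - (\<Sum>i\<in>UNIV. \<theta> $ i * x j $ i) = e j" if "j \<in> {1..N}" for j
    using model[OF that] by simp
  have "max_abs_residual N x y \<theta> \<le> a + c"
    unfolding max_abs_residual_def using nonempty upper resid_\<theta>
    by (subst Max_le_iff) (auto simp: abs_le_iff)
  then have "max_abs_residual N x y T \<le> a + c"
    using min[of \<theta>] by linarith
  then have T: "\<bar>y j - (\<Sum>i\<in>UNIV. T $ i * x j $ i)\<bar> \<le> a + c" if "j \<in> {1..N}" for j
    unfolding max_abs_residual_def using nonempty that by (subst (asm) Max_le_iff) auto
  have shift: "\<bar>e j - v \<bullet> (T - \<theta>)\<bar> \<le> a + c" if "j \<in> J" for j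
  proof -
    have "v \<bullet> (T - \<theta>) = (\<Sum>i\<in>UNIV. T $ i * x j $ i) - (\<Sum>i\<in>UNIV. \<theta> $ i * x j $ i)"
      using block(2)[OF that] by (simp add: inner_vec_def sum_subtractf algebra_simps)
    then show ?thesis
      using T[of j] model[of j] that block(1) by (auto simp: algebra_simps)
  qed
  obtain j j' where "j \<in> J" "a - c < e j" "j' \<in> J" "a - c < - e j'"
    using lower by blast
  with shift[of j] shift[of j'] show ?thesis by linarith
qed

section \<open>Stochastic boundedness\<close>

lemma (in prob_space) bigO_in_probI:
  assumes "\<And>\<delta>. \<delta> > 0 \<Longrightarrow>
    \<forall>\<^sub>F C in at_top. \<forall>n\<ge>1. prob {\<omega> \<in> space M. b n * \<bar>\<xi> n \<omega>\<bar> > C} \<le> \<delta>"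
  shows "bigO_in_prob M \<xi> b"
  unfolding bigO_in_prob_def
proof (rule tendstoI)
  fix \<delta> :: real assume "\<delta> > 0"
  then have "\<forall>\<^sub>F C in at_top. \<forall>n\<ge>1. prob {\<omega> \<in> space M. b n * \<bar>\<xi> n \<omega>\<bar> > C} \<le> \<delta> / 2"
    using assms[of "\<delta> / 2"] by simp
  then show "\<forall>\<^sub>F C in at_top.
      dist (SUP n\<in>{1..}. prob {\<omega> \<in> space M. b n * \<bar>\<xi> n \<omega>\<bar> > C}) 0 < \<delta>"
  proof eventually_elim
    case (elim C)
    let ?p = "\<lambda>n. prob {\<omega> \<in> space M. b n * \<bar>\<xi> n \<omega>\<bar> > C}"
    have "(SUP n\<in>{1..}. ?p n) \<le> \<delta> / 2"
      using elim by (intro cSUP_least) auto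
    moreover have "bdd_above (?p ` {1..})"
      using elim by (intro bdd_aboveI[of _ "\<delta> / 2"]) auto
    then have "?p 1 \<le> (SUP n\<in>{1..}. ?p n)"
      by (intro cSUP_upper) auto
    then have "0 \<le> (SUP n\<in>{1..}. ?p n)"
      using measure_nonneg order_trans by blast
    ultimately show ?case using \<open>\<delta> > 0\<close> by simp
  qed
qed

text \<open>As soon as \<open>b n * e \<ge> C\<close>, a distance above \<open>e\<close> is a distance above \<open>C / b n\<close>.\<close>

lemma (in prob_space) tendsto_in_prob_of_rate:
  fixes X :: "nat \<Rightarrow> 'a \<Rightarrow> 'b :: {metric_space, second_countable_topology}"
  assumes bound: "\<And>\<delta>. \<delta> > 0 \<Longrightarrow>
    \<forall>\<^sub>F C in at_top. \<forall>n\<ge>1. prob {\<omega> \<in> space M. b n * dist (X n \<omega>) c > C} \<le> \<delta>"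
    and X: "\<And>n. n \<ge> 1 \<Longrightarrow> X n \<in> borel_measurable M"
    and b: "filterlim b at_top sequentially"
  shows "tendsto_in_prob M X c"
  unfolding tendsto_in_prob_def
proof (intro allI impI tendstoI)
  fix e \<delta> :: real assume "e > 0" "\<delta> > 0"
  obtain C where C: "C > 0"
    "\<forall>n\<ge>1. prob {\<omega> \<in> space M. b n * dist (X n \<omega>) c > C} \<le> \<delta> / 2"
    using eventually_happens[OF eventually_conj[OF bound[of "\<delta> / 2"] eventually_gt_at_top[of "0::real"]]]
      \<open>\<delta> > 0\<close> by auto
  have "\<forall>\<^sub>F n in sequentially. b n \<ge> C / e"
    using b by (simp add: filterlim_at_top)
  with eventually_ge_at_top[of 1]
  show "\<forall>\<^sub>F n in sequentially. dist (prob {\<omega> \<in> space M. dist (X n \<omega>) c > e}) 0 < \<delta>"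
  proof eventually_elim
    case (elim n)
    note [measurable] = X[OF elim(1)]
    have "C < b n * dist (X n \<omega>) c" if "e < dist (X n \<omega>) c" for \<omega>
    proof -
      have "b n > 0"
        using elim(2) \<open>C > 0\<close> \<open>e > 0\<close> by (meson divide_pos_pos less_le_trans)
      have "C \<le> b n * e"
        using elim(2) \<open>e > 0\<close> by (simp add: field_simps)
      also have "\<dots> < b n * dist (X n \<omega>) c"
        using that \<open>b n > 0\<close> by simp
      finally show ?thesis .
    qed
    then have "prob {\<omega> \<in> space M. dist (X n \<omega>) c > e} \<le> prob {\<omega> \<in> space M. b n * dist (X n \<omega>) c > C}"
      by (intro finite_measure_mono) auto
    also have "\<dots> \<le> \<delta> / 2"
      using C(2) elim(1) by blast
    also have "\<dots> < \<delta>"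
      using \<open>\<delta> > 0\<close> by simp
    finally show ?case by simp
  qed
qed

theorem theorem2:
  fixes M :: "'a measure"
    and V :: "real ^ 'q ^ 'k"
    and I :: "nat \<Rightarrow> 'k \<Rightarrow> nat set"
    and x :: "nat \<Rightarrow> nat \<Rightarrow> real ^ 'q"
    and \<epsilon> :: "nat \<Rightarrow> 'a \<Rightarrow> real"
    and y :: "nat \<Rightarrow> nat \<Rightarrow> 'a \<Rightarrow> real"
    and \<theta> :: "real ^ 'q"
    and \<theta>h :: "nat \<Rightarrow> 'a \<Rightarrow> real ^ 'q"
    and F G :: "real \<Rightarrow> real"
    and a b :: "nat \<Rightarrow> real"
  assumes M: "prob_space M"
    and k_ge_q: "CARD('k) \<ge> CARD('q)"
    and distinct: "inj (\<lambda>l. row l V)"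
    and blocks_disjoint: "\<And>n. n \<ge> 1 \<Longrightarrow> disjoint_family (I n)"
    and blocks_cover: "\<And>n. n \<ge> 1 \<Longrightarrow> (\<Union>l. I n l) = {1..CARD('k) * n}"
    and blocks_card: "\<And>n l. n \<ge> 1 \<Longrightarrow> card (I n l) = n"
    and design: "\<And>n l j. n \<ge> 1 \<Longrightarrow> j \<in> I n l \<Longrightarrow> x n j = row l V"
    and errors_indep: "prob_space.indep_vars M (\<lambda>_. borel) \<epsilon> {1..}"
    and errors_df: "\<And>j. j \<ge> 1 \<Longrightarrow> cdf (distr M borel (\<epsilon> j)) = F"
    and model: "\<And>n j \<omega>. n \<ge> 1 \<Longrightarrow> j \<in> {1..CARD('k) * n} \<Longrightarrow> \<omega> \<in> space M \<Longrightarrow>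
                  y n j \<omega> = (\<Sum>i\<in>UNIV. \<theta> $ i * x n j $ i) + \<epsilon> j \<omega>"
    and A1: "\<And>j. j \<ge> 1 \<Longrightarrow> distr M borel (\<lambda>\<omega>. - \<epsilon> j \<omega>) = distr M borel (\<epsilon> j)"
    and A2: "\<And>n. n \<ge> 1 \<Longrightarrow> b n > 0"
            "extreme_value_df G"
            "weak_conv (\<lambda>n. cdf (distr M borel (\<lambda>\<omega>. b n * (Max ((\<lambda>j. \<epsilon> j \<omega>) ` {1..n}) - a n)))) G"
    and A3: "\<exists>r :: 'q \<Rightarrow> 'k. inj r \<and> det (\<chi> i. row (r i) V) \<noteq> 0"
    and A4: "filterlim b at_top sequentially"
    and mme: "\<And>n. n \<ge> 1 \<Longrightarrow> minimax_estimator M (CARD('k) * n) (x n) (y n) (\<theta>h n)"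
  shows "tendsto_in_prob M \<theta>h \<theta> \<and>
         (\<forall>i. bigO_in_prob M (\<lambda>n \<omega>. \<theta>h n \<omega> $ i - \<theta> $ i) b)"
proof -
  interpret prob_space M by (rule M)
  \<comment> \<open>The sign \<open>s\<close> is \<open>1\<close> or \<open>-1\<close>, so that maxima of \<open>\<epsilon>\<close> and of \<open>-\<epsilon>\<close> are treated together.\<close>
  define \<eta> where "\<eta> s j \<omega> = s * \<epsilon> j \<omega>" for s :: real and j \<omega>
  define Z where "Z s n J \<omega> = b n * (Max ((\<lambda>j. \<eta> s j \<omega>) ` J) - a n)" for s n J \<omega>
  define \<mu> where "\<mu> n = distr M borel (Z 1 n {1..n})" for n
  have \<epsilon>_meas: "\<epsilon> j \<in> borel_measurable M" if "j \<ge> 1" for j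
    using errors_indep that by (auto simp: indep_vars_def)
  have \<eta>_meas [measurable]: "\<eta> s j \<in> borel_measurable M" if "j \<ge> 1" for s j
    unfolding \<eta>_def using \<epsilon>_meas[OF that] by simp
  have Z_meas: "Z s n J \<in> borel_measurable M" if "J \<subseteq> {1..}" "finite J" for s n J
    unfolding Z_def
    by (intro borel_measurable_times borel_measurable_diff borel_measurable_const
        borel_measurable_Max) (use that \<eta>_meas in auto)
  have \<mu>: "real_distribution (\<mu> n)" for n
    unfolding \<mu>_def by (intro real_distribution_distr Z_meas) auto

  \<comment> \<open>Independence and symmetry turn both sides into the same power of \<open>F\<close>.\<close>
  have block_df: "prob {\<omega> \<in> space M. Z s n J \<omega> \<le> t} = cdf (\<mu> n) t"
    if "s \<in> {1, -1}" "n \<ge> 1" "J \<subseteq> {1..}" "card J = n" for s n J t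
  proof -
    have power: "prob {\<omega> \<in> space M. Z s n J \<omega> \<le> t} = F (a n + t / b n) ^ n"
      if "s \<in> {1, -1}" "J \<subseteq> {1..}" "card J = n" for s J
    proof -
      have "Z s n J \<omega> \<le> t \<longleftrightarrow> Max ((\<lambda>j. \<eta> s j \<omega>) ` J) \<le> a n + t / b n" for \<omega>
        using A2(1)[OF \<open>n \<ge> 1\<close>] by (simp add: Z_def field_simps)
      moreover have "indep_vars (\<lambda>_. borel) (\<eta> s) {1..}"
        using indep_vars_compose2[OF errors_indep, of "\<lambda>_. (*) s" "\<lambda>_. borel"]
        by (simp add: \<eta>_def[abs_def])
      moreover have "cdf (distr M borel (\<eta> s j)) = F" if "j \<in> {1..}" for j
        using \<open>s \<in> {1, -1}\<close> A1[of j] errors_df[of j] that by (auto simp: \<eta>_def[abs_def])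
      moreover have "finite J" "J \<noteq> {}"
        using \<open>card J = n\<close> \<open>n \<ge> 1\<close> by (auto intro: card_ge_0_finite)
      ultimately show ?thesis
        using prob_Max_le_indep[of "\<eta> s" "{1..}" F J "a n + t / b n"] that by simp
    qed
    have "cdf (\<mu> n) t = prob {\<omega> \<in> space M. Z 1 n {1..n} \<omega> \<le> t}"
      unfolding cdf_def \<mu>_def using Z_meas[of "{1..n}" 1 n]
      by (subst measure_distr) (auto intro!: arg_cong[where f = prob])
    also have "\<dots> = F (a n + t / b n) ^ n"
      by (intro power) auto
    finally show ?thesis
      using power[OF that(1,3,4)] by simp
  qed

  have conv: "weak_conv (\<lambda>n. cdf (\<mu> n)) G"
    using A2(3) by (simp add: \<mu>_def Z_def[abs_def] \<eta>_def)
  have tight: "\<exists>C>0. \<forall>n. cdf (\<mu> n) C > 1 - \<delta> \<and> cdf (\<mu> n) (- C) < \<delta>" if "\<delta> > 0" for \<delta>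
  proof -
    have "\<forall>\<^sub>F C in at_top. \<forall>n. cdf (\<mu> n) C > 1 - \<delta>"
      using weak_conv_uniform_upper_tail[OF \<mu> conv _ _ that] extreme_value_df_at_top[OF A2(2)]
      by blast
    moreover have "\<forall>\<^sub>F C in at_top. \<forall>n. cdf (\<mu> n) (- C) < \<delta>"
      using weak_conv_uniform_lower_tail[OF \<mu> conv _ _ that] extreme_value_df_at_bot[OF A2(2)]
      by (simp add: at_bot_mirror eventually_filtermap)
    ultimately have "\<forall>\<^sub>F C in at_top. C > 0 \<and> (\<forall>n. cdf (\<mu> n) C > 1 - \<delta> \<and> cdf (\<mu> n) (- C) < \<delta>)"
      using eventually_gt_at_top[of "0::real"] by eventually_elim auto
    then show ?thesis
      using eventually_happens[of _ "at_top :: real filter"] by auto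
  qed

  obtain r :: "'q \<Rightarrow> 'k" where "det (\<chi> i. row (r i) V) \<noteq> 0"
    using A3 by blast
  from norm_le_of_matrix_vector_bounds[OF this]
  obtain K where K: "K > 0" "\<And>u c. (\<And>l. \<bar>(V *v u) $ l\<bar> \<le> c) \<Longrightarrow> norm u \<le> K * c"
    by blast

  have block_sub: "I n l \<subseteq> {1..CARD('k) * n}" if "n \<ge> 1" for n l
    using blocks_cover[OF that] by blast
  have block_fin: "finite (I n l)" if "n \<ge> 1" for n l
    using block_sub[OF that] finite_subset by blast
  have block_ne: "I n l \<noteq> {}" if "n \<ge> 1" for n l
    using blocks_card[OF that, of l] that by auto

  have error_bound: "b n * dist (\<theta>h n \<omega>) \<theta> \<le> 2 * K * C"
    if n: "n \<ge> 1" and \<omega>: "\<omega> \<in> space M"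
      and good: "\<And>l s. s \<in> {1, -1} \<Longrightarrow> - C < Z s n (I n l) \<omega> \<and> Z s n (I n l) \<omega> \<le> C" for n \<omega> C
  proof -
    define c where "c = C / b n"
    have b: "b n > 0" by (rule A2(1)[OF n])
    have max: "a n - c < Max ((\<lambda>j. \<eta> s j \<omega>) ` I n l)" "Max ((\<lambda>j. \<eta> s j \<omega>) ` I n l) \<le> a n + c"
      if "s \<in> {1, -1}" for s l
      using good[OF that, of l] b by (auto simp: Z_def c_def field_simps)
    have upper: "\<eta> s j \<omega> \<le> a n + c" if "s \<in> {1, -1}" "j \<in> {1..CARD('k) * n}" for s j
    proof -
      obtain l where "j \<in> I n l"
        using blocks_cover[OF n] \<open>j \<in> _\<close> by blast
      then have "\<eta> s j \<omega> \<le> Max ((\<lambda>j. \<eta> s j \<omega>) ` I n l)"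
        using block_fin[OF n] by simp
      with max(2)[OF that(1), of l] show ?thesis by linarith
    qed
    have lower: "\<exists>j\<in>I n l. a n - c < \<eta> s j \<omega>" if "s \<in> {1, -1}" for s l
      using max(1)[OF that, of l] block_fin[OF n, of l] block_ne[OF n, of l]
      by (subst (asm) Max_gr_iff) auto
    have "\<bar>row l V \<bullet> (\<theta>h n \<omega> - \<theta>)\<bar> \<le> 2 * c" for l
    proof (rule minimiser_block_shift_le[where N = "CARD('k) * n" and x = "x n"
          and y = "\<lambda>j. y n j \<omega>" and e = "\<lambda>j. \<epsilon> j \<omega>" and a = "a n" and J = "I n l"])
      show "max_abs_residual (CARD('k) * n) (x n) (\<lambda>j. y n j \<omega>) (\<theta>h n \<omega>)
              \<le> max_abs_residual (CARD('k) * n) (x n) (\<lambda>j. y n j \<omega>) \<tau>" for \<tau>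
        using mme[OF n] \<omega> by (auto simp: minimax_estimator_def)
    qed (use n \<omega> model design block_sub upper[of 1] upper[of "-1"] lower[of 1] lower[of "-1"]
        in \<open>auto simp: \<eta>_def\<close>)
    then have "norm (\<theta>h n \<omega> - \<theta>) \<le> K * (2 * c)"
      by (intro K(2)) (simp add: matrix_vector_mul_component row_def inner_vec_def vec_lambda_eta)
    then show ?thesis
      using b by (simp add: c_def dist_norm field_simps)
  qed

  have rate: "\<forall>\<^sub>F C in at_top. \<forall>n\<ge>1. prob {\<omega> \<in> space M. b n * dist (\<theta>h n \<omega>) \<theta> > C} \<le> \<delta>"
    if "\<delta> > 0" for \<delta>
  proof -
    \<comment> \<open>Each of the \<open>2 * CARD('k)\<close> block maxima has two tails, so each tail gets this share of \<open>\<delta>\<close>.\<close>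
    define \<delta>' where "\<delta>' = \<delta> / (4 * real CARD('k))"
    have "\<delta>' > 0" using that by (simp add: \<delta>'_def)
    then obtain C where C: "\<And>n. cdf (\<mu> n) C > 1 - \<delta>'" "\<And>n. cdf (\<mu> n) (- C) < \<delta>'"
      using tight by blast
    show ?thesis
      using eventually_ge_at_top[of "2 * K * C"]
    proof (eventually_elim, intro allI impI)
      fix C' n assume C': "2 * K * C \<le> C'" and n: "(1::nat) \<le> n"
      define bad where "bad p = {\<omega> \<in> space M. Z (snd p) n (I n (fst p)) \<omega> \<le> - C} \<union>
        (space M - {\<omega> \<in> space M. Z (snd p) n (I n (fst p)) \<omega> \<le> C})" for p :: "'k \<times> real"
      let ?P = "UNIV \<times> {1, -1} :: ('k \<times> real) set"
      have I1: "I n l \<subseteq> {1..}" for l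
        using block_sub[OF n, of l] by auto
      have Zn [measurable]: "Z s n (I n l) \<in> borel_measurable M" for s l
        by (intro Z_meas I1 block_fin n)
      have bad_sets: "bad p \<in> events" for p
        unfolding bad_def by measurable
      have "prob (bad p) \<le> 2 * \<delta>'" if "p \<in> ?P" for p
      proof -
        have s: "snd p \<in> {1, -1}" using that by auto
        have df: "prob {\<omega> \<in> space M. Z (snd p) n (I n (fst p)) \<omega> \<le> t} = cdf (\<mu> n) t" for t
          by (rule block_df[OF s n I1 blocks_card[OF n]])
        have "prob (bad p) \<le> prob {\<omega> \<in> space M. Z (snd p) n (I n (fst p)) \<omega> \<le> - C} +
            prob (space M - {\<omega> \<in> space M. Z (snd p) n (I n (fst p)) \<omega> \<le> C})"
          unfolding bad_def by (intro measure_Un_le) measurable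
        also have "\<dots> = cdf (\<mu> n) (- C) + (1 - cdf (\<mu> n) C)"
          by (subst prob_compl) (measurable, simp add: df)
        finally have "prob (bad p) \<le> cdf (\<mu> n) (- C) + (1 - cdf (\<mu> n) C)" .
        with C[of n] show ?thesis by linarith
      qed
      then have "(\<Sum>p\<in>?P. prob (bad p)) \<le> real (card ?P) * (2 * \<delta>')"
        using sum_bounded_above[of ?P "\<lambda>p. prob (bad p)" "2 * \<delta>'"] by simp
      also have "\<dots> = \<delta>"
        by (simp add: card_cartesian_product \<delta>'_def)
      finally have sum: "(\<Sum>p\<in>?P. prob (bad p)) \<le> \<delta>" .
      have "{\<omega> \<in> space M. b n * dist (\<theta>h n \<omega>) \<theta> > C'} \<subseteq> (\<Union>p\<in>?P. bad p)"
      proof (rule subsetI, rule ccontr)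
        fix \<omega> assume \<omega>: "\<omega> \<in> {\<omega> \<in> space M. b n * dist (\<theta>h n \<omega>) \<theta> > C'}"
          and not_bad: "\<omega> \<notin> (\<Union>p\<in>?P. bad p)"
        have "- C < Z s n (I n l) \<omega> \<and> Z s n (I n l) \<omega> \<le> C" if "s \<in> {1, -1}" for l s
        proof -
          have "\<omega> \<notin> bad (l, s)"
            using not_bad that by blast
          with \<omega> show ?thesis by (simp add: bad_def not_le)
        qed
        then have "b n * dist (\<theta>h n \<omega>) \<theta> \<le> 2 * K * C"
          using \<omega> by (intro error_bound[OF n]) auto
        with \<omega> C' show False by simp
      qed
      then have "prob {\<omega> \<in> space M. b n * dist (\<theta>h n \<omega>) \<theta> > C'} \<le> prob (\<Union>p\<in>?P. bad p)"
        using bad_sets by (intro finite_measure_mono) auto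
      also have "\<dots> \<le> (\<Sum>p\<in>?P. prob (bad p))"
        using bad_sets by (intro measure_UNION_le) auto
      finally show "prob {\<omega> \<in> space M. b n * dist (\<theta>h n \<omega>) \<theta> > C'} \<le> \<delta>"
        using sum by linarith
    qed
  qed

  have \<theta>h_meas: "\<theta>h n \<in> borel_measurable M" if "n \<ge> 1" for n
    using mme[OF that] by (simp add: minimax_estimator_def)
  have "bigO_in_prob M (\<lambda>n \<omega>. \<theta>h n \<omega> $ i - \<theta> $ i) b" for i
  proof (rule bigO_in_probI)
    fix \<delta> :: real assume "\<delta> > 0"
    from rate[OF this]
    show "\<forall>\<^sub>F C in at_top. \<forall>n\<ge>1. prob {\<omega> \<in> space M. b n * \<bar>\<theta>h n \<omega> $ i - \<theta> $ i\<bar> > C} \<le> \<delta>"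
    proof (eventually_elim, intro allI impI)
      fix C n
      assume C: "\<forall>n\<ge>1. prob {\<omega> \<in> space M. b n * dist (\<theta>h n \<omega>) \<theta> > C} \<le> \<delta>" and n: "(1::nat) \<le> n"
      note [measurable] = \<theta>h_meas[OF n]
      have "b n * \<bar>\<theta>h n \<omega> $ i - \<theta> $ i\<bar> \<le> b n * dist (\<theta>h n \<omega>) \<theta>" for \<omega>
        using A2(1)[OF n] component_le_norm_cart[of "\<theta>h n \<omega> - \<theta>" i] by (simp add: dist_norm)
      then have "prob {\<omega> \<in> space M. b n * \<bar>\<theta>h n \<omega> $ i - \<theta> $ i\<bar> > C}
          \<le> prob {\<omega> \<in> space M. b n * dist (\<theta>h n \<omega>) \<theta> > C}"
        by (intro finite_measure_mono) (auto intro: less_le_trans)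
      also have "\<dots> \<le> \<delta>"
        using C n by blast
      finally show "prob {\<omega> \<in> space M. b n * \<bar>\<theta>h n \<omega> $ i - \<theta> $ i\<bar> > C} \<le> \<delta>" .
    qed
  qed
  with tendsto_in_prob_of_rate[OF rate \<theta>h_meas A4] show ?thesis by blast
qed

end
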